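(* Let $n \ge 1$ and let $\mathcal{F}$ be a family of (simple, labelled) graphs, each with vertex set $\{1, 2, \ldots, n\}$, such that for all $G, H \in \mathcal{F}$ (including $G = H$) the graph $G \cap H$ is connected. Then $|\mathcal{F}| \leq 2^{\binom{n}{2}} / 2^{n-1}$. Consequently, $\mu(\text{connected}, n) = 2^{-n+1}$.
   Context: For graphs $G, H$ on the common vertex set $V = \{1,\ldots,n\}$, $G \cap H$ denotes the graph on $V$ with edge set $E(G) \cap E(H)$; it is connected if it is connected as a graph on all of $V$. For a graph property $\mathcal{P}$, a family $\mathcal{F}$ of graphs on $V$ is called $\mathcal{P}$-intersecting if $G \cap H$ satisfies $\mathcal{P}$ for all $G, H \in \mathcal{F}$. Define $\mu(\mathcal{P}, n) := \max\{ |\mathcal{F}| \cdot 2^{-\binom{n}{2}} : \mathcal{F} \text{ is a } \mathcal{P}\text{-intersecting family of graphs on } \{1,\ldots,n\}\}$, i.e. the maximum fraction of all $2^{\binom{n}{2}}$ labelled graphs on $\{1,\ldots,n\}$ that a $\mathcal{P}$-intersecting family can contain. Here $\mathcal{P}$ = "is connected". *)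

theory Defs
  imports Complex_Main "Graph_Theory.Digraph_Component"
begin

text \<open>
  A simple undirected graph is a \<^const>\<open>pair_graph\<close>: a finite loop-free digraph without parallel
  arcs whose arc relation is symmetric, so that an edge \<open>{u, v}\<close> is the pair of arcs
  \<open>(u, v)\<close>, \<open>(v, u)\<close>.  That this yields each labelled graph exactly once is
  confirmed by \<open>card_labelled_graphs\<close> below.
\<close>

definition labelled_graphs :: "nat \<Rightarrow> nat pair_pre_digraph set" where
  "labelled_graphs n = {G. pair_graph G \<and> pverts G = {1..n}}"

definition graph_inter :: "'a pair_pre_digraph \<Rightarrow> 'a pair_pre_digraph \<Rightarrow> 'a pair_pre_digraph"
  (infixl \<open>\<inter>\<^sub>G\<close> 70) where
  "G \<inter>\<^sub>G H = \<lparr> pverts = pverts G \<inter> pverts H, parcs = parcs G \<inter> parcs H \<rparr>"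

text \<open>
  The qualified name distinguishes graph connectedness from topological connectedness.
\<close>

definition graph_connected :: "'a pair_pre_digraph \<Rightarrow> bool" where
  "graph_connected G \<longleftrightarrow> Digraph_Component.connected (with_proj G)"

definition intersecting :: "('a pair_pre_digraph \<Rightarrow> bool) \<Rightarrow> 'a pair_pre_digraph set \<Rightarrow> bool" where
  "intersecting P \<F> \<longleftrightarrow> (\<forall>G \<in> \<F>. \<forall>H \<in> \<F>. P (G \<inter>\<^sub>G H))"

text \<open>
  The maximum is over a finite nonempty set, see \<open>finite_intersecting_fractions\<close> and
  \<open>intersecting_fractions_nonempty\<close>.
\<close>

definition intersecting_fractions :: "(nat pair_pre_digraph \<Rightarrow> bool) \<Rightarrow> nat \<Rightarrow> real set" where
  "intersecting_fractions P n =
     {real (card \<F>) / 2 ^ (n choose 2) | \<F>. \<F> \<subseteq> labelled_graphs n \<and> intersecting P \<F>}"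

definition \<mu> :: "(nat pair_pre_digraph \<Rightarrow> bool) \<Rightarrow> nat \<Rightarrow> real" where
  "\<mu> P n = Max (intersecting_fractions P n)"

lemma pair_graph_iff:
  "pair_graph G \<longleftrightarrow> finite (pverts G) \<and> parcs G \<subseteq> pverts G \<times> pverts G \<and>
     sym (parcs G) \<and> irrefl (parcs G)"
  (is "?L \<longleftrightarrow> ?R")
proof
  assume ?L
  then interpret pair_graph G .
  show ?R
    using pair_finite_verts arc_fst_in_verts arc_snd_in_verts pair_sym_arcs pair_no_loops
    by (fastforce simp: symmetric_def irrefl_def)
next
  assume R: ?R
  then have "finite (parcs G)"
    by (meson finite_SigmaI finite_subset)
  with R show ?L
    by unfold_locales (auto simp: symmetric_def irrefl_def)
qed

lemma card_labelled_graphs: "card (labelled_graphs n) = 2 ^ (n choose 2)"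
proof -
  define E where "E = {e. e \<subseteq> {1..n} \<and> card e = 2}"
  define f :: "nat set set \<Rightarrow> nat pair_pre_digraph"
    where "f S = \<lparr> pverts = {1..n}, parcs = {(u, v). u \<noteq> v \<and> {u, v} \<in> S} \<rparr>" for S
  define g :: "nat pair_pre_digraph \<Rightarrow> nat set set"
    where "g G = {{u, v} | u v. (u, v) \<in> parcs G}" for G
  have "bij_betw f (Pow E) (labelled_graphs n)"
  proof (rule bij_betw_byWitness[where f' = g])
    show "\<forall>S \<in> Pow E. g (f S) = S"
    proof
      fix S assume "S \<in> Pow E"
      then have "\<exists>u v. e = {u, v} \<and> u \<noteq> v" if "e \<in> S" for e
        using that by (auto simp: E_def card_2_iff)
      then show "g (f S) = S"
        by (fastforce simp: f_def g_def)
    qed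
    show "\<forall>G \<in> labelled_graphs n. f (g G) = G"
    proof
      fix G assume "G \<in> labelled_graphs n"
      then have G: "pverts G = {1..n}" "sym (parcs G)" "irrefl (parcs G)"
        by (auto simp: labelled_graphs_def pair_graph_iff)
      have "(u, v) \<in> parcs (f (g G)) \<longleftrightarrow> (u, v) \<in> parcs G" for u v
      proof -
        have "(u, v) \<in> parcs (f (g G)) \<longleftrightarrow> u \<noteq> v \<and> (\<exists>x y. {u, v} = {x, y} \<and> (x, y) \<in> parcs G)"
          by (simp add: f_def g_def)
        also have "\<dots> \<longleftrightarrow> u \<noteq> v \<and> ((u, v) \<in> parcs G \<or> (v, u) \<in> parcs G)"
          unfolding doubleton_eq_iff by blast
        also have "\<dots> \<longleftrightarrow> (u, v) \<in> parcs G"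
          using G(2,3) unfolding sym_def irrefl_def by blast
        finally show ?thesis .
      qed
      then have "parcs (f (g G)) = parcs G"
        by auto
      with G(1) show "f (g G) = G"
        by (simp add: f_def)
    qed
    show "f ` Pow E \<subseteq> labelled_graphs n"
    proof (rule image_subsetI)
      fix S assume "S \<in> Pow E"
      then have "u \<in> {1..n} \<and> v \<in> {1..n}" if "{u, v} \<in> S" for u v
        using that unfolding E_def by blast
      then have "{(u, v). u \<noteq> v \<and> {u, v} \<in> S} \<subseteq> {1..n} \<times> {1..n}"
        by blast
      moreover have "sym {(u, v). u \<noteq> v \<and> {u, v} \<in> S}"
        by (rule symI) (simp add: insert_commute)
      ultimately show "f S \<in> labelled_graphs n"
        by (simp add: labelled_graphs_def pair_graph_iff f_def irrefl_def)
    qed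
    show "g ` labelled_graphs n \<subseteq> Pow E"
    proof (intro image_subsetI PowI subsetI)
      fix G e assume G: "G \<in> labelled_graphs n" and "e \<in> g G"
      then obtain u v where e: "e = {u, v}" "(u, v) \<in> parcs G"
        unfolding g_def by blast
      then have "u \<in> {1..n}" "v \<in> {1..n}" "u \<noteq> v"
        using G unfolding labelled_graphs_def pair_graph_iff irrefl_def by blast+
      with e(1) show "e \<in> E"
        by (simp add: E_def)
    qed
  qed
  then have "card (labelled_graphs n) = card (Pow E)"
    by (metis bij_betw_same_card)
  also have "\<dots> = 2 ^ (n choose 2)"
    by (simp add: E_def card_Pow n_subsets)
  finally show ?thesis .
qed

lemma finite_labelled_graphs: "finite (labelled_graphs n)"
  by (rule card_ge_0_finite) (simp add: card_labelled_graphs)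

lemma finite_intersecting_fractions: "finite (intersecting_fractions P n)"
proof (rule finite_subset)
  show "intersecting_fractions P n \<subseteq>
      (\<lambda>\<F>. real (card \<F>) / 2 ^ (n choose 2)) ` Pow (labelled_graphs n)"
    by (auto simp: intersecting_fractions_def)
qed (simp add: finite_labelled_graphs)

lemma intersecting_fractions_nonempty: "intersecting_fractions P n \<noteq> {}"
  by (auto simp: intersecting_fractions_def intersecting_def)

end

theory Submission
  imports Defs
begin

text \<open>
  The cuts of the complete graph form a vector space of dimension \<open>n - 1\<close> over the field with
  two elements.  If two distinct graphs differ by a cut, then no edge of that cut lies in both of
  them, so their intersection is disconnected.  Hence a family with connected intersections meets
  every coset of the cut space at most once.  Equality is attained by the graphs that contain a
  fixed spanning star.
\<close>

text \<open>A walk from \<open>u\<close> to \<open>v\<close> must leave \<open>A\<close> at some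
  step. Connectedness is reachability in the symmetric closure, so that step may run against the arc
  of \<open>G\<close>; hence a conclusion indifferent to direction.\<close>

lemma graph_connected_crossing_arc:
  assumes conn: "graph_connected G"
    and u: "u \<in> pverts G" "u \<in> A" and v: "v \<in> pverts G" "v \<notin> A"
  obtains x y where "(x, y) \<in> parcs G" "x \<in> A \<longleftrightarrow> y \<notin> A"
proof -
  have "(u, v) \<in> rtrancl_on (pverts G) (parcs (mk_symmetric (with_proj G)))"
    using conn u v
    by (simp add: graph_connected_def connected_def strongly_connected_def reachable_def)
  \<comment> \<open>Invariant along the walk: it stays in \<open>A\<close> until a crossing arc has
    been found.\<close>
  moreover have "w \<in> A \<or> (\<exists>(x, y) \<in> parcs G. x \<in> A \<longleftrightarrow> y \<notin> A)"
    if "(u, w) \<in> rtrancl_on (pverts G) (parcs (mk_symmetric (with_proj G)))" for w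
    using that
  proof (induction rule: rtrancl_on_induct)
    case base
    then show ?case using u by simp
  next
    case (step y z)
    then have "(y, z) \<in> parcs G \<or> (z, y) \<in> parcs G"
      by (auto simp: parcs_mk_symmetric)
    then show ?case using step.IH by blast
  qed
  ultimately show thesis using v that by blast
qed

text \<open>Any two vertices are joined by a walk through the centre \<open>c\<close>.\<close>

lemma graph_connected_if_dominating_vertex:
  assumes c: "c \<in> pverts G" and star: "\<And>v. v \<in> pverts G \<Longrightarrow> v \<noteq> c \<Longrightarrow> (c, v) \<in> parcs G"
  shows "graph_connected G"
proof -
  let ?R = "rtrancl_on (pverts G) (parcs (mk_symmetric (with_proj G)))"
  have arcs: "(c, v) \<in> parcs (mk_symmetric (with_proj G))"
       "(v, c) \<in> parcs (mk_symmetric (with_proj G))" if "v \<in> pverts G" "v \<noteq> c" for v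
    using star[OF that] by (auto simp: parcs_mk_symmetric intro!: bexI[of _ "(c, v)"])
  have "(u, c) \<in> ?R \<and> (c, u) \<in> ?R" if "u \<in> pverts G" for u
    using that c arcs[OF that] by (cases "u = c") (auto intro: rtrancl_on_into_rtrancl_on)
  then have "(u, v) \<in> ?R" if "u \<in> pverts G" "v \<in> pverts G" for u v
    using that by (meson rtrancl_on_trans)
  then show ?thesis
    using c by (auto simp: graph_connected_def connected_def strongly_connected_def reachable_def)
qed

text \<open>Translation by a cut vector over the field with two elements: arcs between
  \<open>A\<close> and its complement are toggled, all others keep their status. Loops are never
  toggled, as both ends lie on the same side.\<close>

definition add_cut :: "'a pair_pre_digraph \<Rightarrow> 'a set \<Rightarrow> 'a pair_pre_digraph" where
  "add_cut G A = \<lparr> pverts = pverts G,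
     parcs = {(u, v) \<in> pverts G \<times> pverts G. (u, v) \<in> parcs G \<longleftrightarrow> (u \<in> A \<longleftrightarrow> v \<in> A)} \<rparr>"

lemma mem_parcs_add_cut:
  "(u, v) \<in> parcs (add_cut G A) \<longleftrightarrow>
     u \<in> pverts G \<and> v \<in> pverts G \<and> ((u, v) \<in> parcs G \<longleftrightarrow> (u \<in> A \<longleftrightarrow> v \<in> A))"
  by (simp add: add_cut_def)

lemma labelled_graphsD:
  assumes "G \<in> labelled_graphs n"
  shows "pverts G = {1..n}" "(u, v) \<in> parcs G \<Longrightarrow> u \<in> {1..n} \<and> v \<in> {1..n} \<and> u \<noteq> v"
    "(u, v) \<in> parcs G \<longleftrightarrow> (v, u) \<in> parcs G"
  using assms unfolding labelled_graphs_def pair_graph_iff sym_def irrefl_def by blast+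

lemma labelled_graphs_eqI:
  assumes "G \<in> labelled_graphs n" "H \<in> labelled_graphs n"
    and "\<And>u v. u \<in> {1..n} \<Longrightarrow> v \<in> {1..n} \<Longrightarrow> (u, v) \<in> parcs G \<longleftrightarrow> (u, v) \<in> parcs H"
  shows "G = H"
proof -
  have "parcs G = parcs H"
    using assms(3) labelled_graphsD(2)[OF assms(1)] labelled_graphsD(2)[OF assms(2)]
    by (intro set_eqI) (metis surj_pair)
  then show ?thesis
    using labelled_graphsD(1)[OF assms(1)] labelled_graphsD(1)[OF assms(2)] by simp
qed

lemma add_cut_in_labelled_graphs:
  assumes "G \<in> labelled_graphs n"
  shows "add_cut G A \<in> labelled_graphs n"
  using labelled_graphsD[OF assms]
  unfolding labelled_graphs_def pair_graph_iff sym_def irrefl_def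
  by (auto simp: add_cut_def)

lemma card_connected_intersecting_le:
  assumes n: "n \<ge> 1" and F: "\<F> \<subseteq> labelled_graphs n" and int: "intersecting graph_connected \<F>"
  shows "card \<F> * 2 ^ (n - 1) \<le> 2 ^ (n choose 2)"
proof -
  \<comment> \<open>A set and its complement define the same cut. Keeping vertex 1 outside picks one
    representative of each, leaving \<open>2 ^ (n - 1)\<close> cuts.\<close>
  have "inj_on (\<lambda>(G, A). add_cut G A) (\<F> \<times> Pow {2..n})"
  proof (rule inj_onI, clarify)
    fix G A H B
    assume G: "G \<in> \<F>" and H: "H \<in> \<F>" and A: "A \<subseteq> {2..n}" and B: "B \<subseteq> {2..n}"
      and eq: "add_cut G A = add_cut H B"
    have GL: "G \<in> labelled_graphs n" and HL: "H \<in> labelled_graphs n"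
      using F G H by auto
    note verts = labelled_graphsD(1)[OF GL] labelled_graphsD(1)[OF HL]
    have arc_eq: "((u, v) \<in> parcs G \<longleftrightarrow> (u \<in> A \<longleftrightarrow> v \<in> A)) \<longleftrightarrow> ((u, v) \<in> parcs H \<longleftrightarrow> (u \<in> B \<longleftrightarrow> v \<in> B))"
      if "u \<in> {1..n}" "v \<in> {1..n}" for u v
      using eq mem_parcs_add_cut[of u v G A] mem_parcs_add_cut[of u v H B] that verts by simp
    have "A = B"
    proof (rule ccontr)
      assume "A \<noteq> B"
      \<comment> \<open>The cut of \<open>D\<close> is the sum of the cuts of \<open>A\<close> and
        \<open>B\<close>. Both sides of \<open>D\<close> are nonempty: \<open>u\<close> lies inside
        and 1 outside.\<close>
      define D where "D = sym_diff A B"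
      obtain u where u: "u \<in> D"
        using \<open>A \<noteq> B\<close> by (auto simp: D_def)
      have D: "D \<subseteq> {2..n}"
        using A B by (auto simp: D_def)
      obtain x y where xy: "(x, y) \<in> parcs (G \<inter>\<^sub>G H)" "x \<in> D \<longleftrightarrow> y \<notin> D"
      proof (rule graph_connected_crossing_arc)
        show "graph_connected (G \<inter>\<^sub>G H)"
          using int G H by (simp add: intersecting_def)
        show "u \<in> pverts (G \<inter>\<^sub>G H)" "1 \<in> pverts (G \<inter>\<^sub>G H)"
          using u D n by (auto simp: graph_inter_def verts)
        show "1 \<notin> D" using D by auto
      qed (use u in auto)
      then have "(x, y) \<in> parcs G" "(x, y) \<in> parcs H"
        by (simp_all add: graph_inter_def)
      moreover from this have "x \<in> {1..n}" "y \<in> {1..n}"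
        using labelled_graphsD(2)[OF GL] by blast+
      \<comment> \<open>The arc is present in both graphs and has the same status after both
        translations, so it lies in both cuts or in neither and cannot cross
        \<open>D\<close>.\<close>
      ultimately have "(x \<in> A \<longleftrightarrow> y \<in> A) \<longleftrightarrow> (x \<in> B \<longleftrightarrow> y \<in> B)"
        using arc_eq by blast
      with xy(2) show False
        unfolding D_def by blast
    qed
    moreover have "G = H"
      \<comment> \<open>Toggling the same cut on both sides cancels.\<close>
      using GL HL by (rule labelled_graphs_eqI) (use arc_eq \<open>A = B\<close> in blast)
    ultimately show "G = H \<and> A = B" by simp
  qed
  moreover have "(\<lambda>(G, A). add_cut G A) ` (\<F> \<times> Pow {2..n}) \<subseteq> labelled_graphs n"
    using F add_cut_in_labelled_graphs by auto
  ultimately have "card (\<F> \<times> Pow {2..n}) \<le> card (labelled_graphs n)"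
    using finite_labelled_graphs by (rule card_inj_on_le)
  then show ?thesis
    by (simp add: card_cartesian_product card_Pow card_labelled_graphs)
qed

definition star_graphs :: "nat \<Rightarrow> nat pair_pre_digraph set" where
  "star_graphs n = {G \<in> labelled_graphs n. \<forall>v \<in> {2..n}. (1, v) \<in> parcs G}"

lemma star_graphs_intersecting:
  assumes "n \<ge> 1"
  shows "intersecting graph_connected (star_graphs n)"
  unfolding intersecting_def
proof (intro ballI)
  fix G H assume GH: "G \<in> star_graphs n" "H \<in> star_graphs n"
  then have "pverts G = {1..n}" "pverts H = {1..n}"
    unfolding star_graphs_def using labelled_graphsD(1) by blast+
  with GH assms show "graph_connected (G \<inter>\<^sub>G H)"
    by (intro graph_connected_if_dominating_vertex[of 1]) (auto simp: graph_inter_def star_graphs_def)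
qed

definition add_star :: "nat pair_pre_digraph \<Rightarrow> nat pair_pre_digraph" where
  "add_star G = \<lparr> pverts = pverts G,
     parcs = parcs G \<union> {(u, v) \<in> pverts G \<times> pverts G. u \<noteq> v \<and> (u = 1 \<or> v = 1)} \<rparr>"

lemma add_star_in_star_graphs:
  assumes "n \<ge> 1" "G \<in> labelled_graphs n"
  shows "add_star G \<in> star_graphs n"
  using assms(1) labelled_graphsD[OF assms(2)]
  unfolding star_graphs_def labelled_graphs_def pair_graph_iff sym_def irrefl_def
  by (auto simp: add_star_def) blast+

text \<open>A graph is determined by its completion with the star at 1 together with the
  neighbourhood of 1, which is one of the \<open>2 ^ (n - 1)\<close> subsets of
  \<open>{2..n}\<close>.\<close>

lemma card_star_graphs_ge:
  assumes n: "n \<ge> 1"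
  shows "2 ^ (n choose 2) \<le> card (star_graphs n) * 2 ^ (n - 1)"
proof -
  let ?f = "\<lambda>G. (add_star G, {v. (1, v) \<in> parcs G})"
  have "inj_on ?f (labelled_graphs n)"
  proof (rule inj_onI)
    fix G H
    assume GL: "G \<in> labelled_graphs n" and HL: "H \<in> labelled_graphs n" and eq: "?f G = ?f H"
    have one: "(1, v) \<in> parcs G \<longleftrightarrow> (1, v) \<in> parcs H" for v
      using eq by blast
    have "parcs (add_star G) = parcs (add_star H)"
      using eq by simp
    \<comment> \<open>Completion changes only arcs at vertex 1, so all others can be read off from
      it.\<close>
    then have other: "(u, v) \<in> parcs G \<longleftrightarrow> (u, v) \<in> parcs H" if "u \<noteq> 1" "v \<noteq> 1" for u v
      using that by (auto simp: add_star_def set_eq_iff)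
    show "G = H"
      using GL HL
    proof (rule labelled_graphs_eqI)
      fix u v
      \<comment> \<open>Arcs out of 1 agree by \<open>one\<close>, arcs into 1 by symmetry, the rest
        by \<open>other\<close>.\<close>
      show "(u, v) \<in> parcs G \<longleftrightarrow> (u, v) \<in> parcs H"
        using one other labelled_graphsD(3)[OF GL] labelled_graphsD(3)[OF HL] by metis
    qed
  qed
  moreover have "?f ` labelled_graphs n \<subseteq> star_graphs n \<times> Pow {2..n}"
  proof -
    have "{v. (1, v) \<in> parcs G} \<subseteq> {2..n}" if "G \<in> labelled_graphs n" for G
      using labelled_graphsD(2)[OF that, of 1] by fastforce
    then show ?thesis
      using add_star_in_star_graphs[OF n] by blast
  qed
  moreover have "finite (star_graphs n \<times> Pow {2..n})"
    using finite_labelled_graphs by (simp add: star_graphs_def)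
  ultimately have "card (labelled_graphs n) \<le> card (star_graphs n \<times> Pow {2..n})"
    by (rule card_inj_on_le)
  then show ?thesis
    by (simp add: card_cartesian_product card_Pow card_labelled_graphs)
qed

theorem theorem2:
  fixes n :: nat
  assumes "n \<ge> 1"
  shows "(\<forall>\<F>. \<F> \<subseteq> labelled_graphs n \<and> intersecting graph_connected \<F> \<longrightarrow>
            real (card \<F>) \<le> 2 ^ (n choose 2) / 2 ^ (n - 1)) \<and>
         \<mu> graph_connected n = 2 powi (- int n + 1)"
proof (intro conjI allI impI)
  have le: "real (card \<F>) * 2 ^ (n - 1) \<le> 2 ^ (n choose 2)"
    if "\<F> \<subseteq> labelled_graphs n" "intersecting graph_connected \<F>" for \<F>
    using of_nat_mono[OF card_connected_intersecting_le[OF assms that], where 'a = real] by simp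
  then show "real (card \<F>) \<le> 2 ^ (n choose 2) / 2 ^ (n - 1)"
    if "\<F> \<subseteq> labelled_graphs n \<and> intersecting graph_connected \<F>" for \<F>
    using that by (simp add: field_simps)
  have star: "star_graphs n \<subseteq> labelled_graphs n" "intersecting graph_connected (star_graphs n)"
    using star_graphs_intersecting[OF assms] by (auto simp: star_graphs_def)
  have "2 ^ (n choose 2) \<le> real (card (star_graphs n)) * 2 ^ (n - 1)"
    using of_nat_mono[OF card_star_graphs_ge[OF assms], where 'a = real] by simp
  \<comment> \<open>The general upper bound, applied to the star family itself, supplies the reverse
    inequality to the count.\<close>
  with le[OF star] have "real (card (star_graphs n)) * 2 ^ (n - 1) = 2 ^ (n choose 2)"
    by linarith
  then have frac: "real (card (star_graphs n)) / 2 ^ (n choose 2) = 1 / 2 ^ (n - 1)"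
    by (simp add: frac_eq_eq)
  have "\<mu> graph_connected n = 1 / 2 ^ (n - 1)"
    unfolding \<mu>_def
  proof (rule Max_eqI)
    show "1 / 2 ^ (n - 1) \<in> intersecting_fractions graph_connected n"
      unfolding intersecting_fractions_def mem_Collect_eq
      by (rule exI[of _ "star_graphs n"]) (simp only: star frac simp_thms)
    show "x \<le> 1 / 2 ^ (n - 1)" if "x \<in> intersecting_fractions graph_connected n" for x
    proof -
      from that obtain \<F> where x: "x = real (card \<F>) / 2 ^ (n choose 2)"
        and F: "\<F> \<subseteq> labelled_graphs n" "intersecting graph_connected \<F>"
        by (auto simp: intersecting_fractions_def)
      show ?thesis
        using le[OF F] by (simp add: x divide_le_eq le_divide_eq)
    qed
  qed (rule finite_intersecting_fractions)
  also have "\<dots> = 2 powi (- int n + 1)"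
  proof -
    \<comment> \<open>The truncated subtraction \<open>n - 1\<close> is exact because
      \<open>n\<close> is at least 1.\<close>
    have "- int n + 1 = - int (n - 1)"
      using assms by simp
    then show ?thesis
      by (simp only: power_int_minus power_int_of_nat inverse_eq_divide)
  qed
  finally show "\<mu> graph_connected n = 2 powi (- int n + 1)" .
qed

end
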